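(* Let $R$ be a commutative ring with identity. If $R$ is Artinian, then $R$ is a sober ring.
   Context: $\operatorname{Spec}(R)$ denotes the set of all prime ideals of $R$ and $\operatorname{Max}(R)$ the set of all maximal ideals of $R$. A ring is Artinian if it satisfies the descending chain condition on ideals. A commutative ring $R$ with identity is called a sober ring if for every $P\in\operatorname{Spec}(R)$ with $P\notin\operatorname{Max}(R)$ one has \[ P\neq \bigcap_{Q\in\operatorname{Spec}(R),\ P\subsetneq Q} Q . \] (This is a condition on the ideals of the ring; it is not the topological notion of a sober space.) *)

theory Defs
  imports "HOL-Algebra.Algebra"
begin

definition Spec :: "('a, 'b) ring_scheme \<Rightarrow> 'a set set"
  where "Spec R = {P. primeideal P R}"

definition MaxSpec :: "('a, 'b) ring_scheme \<Rightarrow> 'a set set"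
  where "MaxSpec R = {M. maximalideal M R}"

locale artinian_ring = ring +
  assumes dcc:
    "\<lbrakk>\<And>n::nat. ideal (I n) R; \<And>n. I (Suc n) \<subseteq> I n\<rbrakk> \<Longrightarrow> \<exists>N. \<forall>n\<ge>N. I n = I N"

(* The intersection is taken inside the carrier, so that an empty family would yield
   the whole ring rather than the universe of the type. (The family is in fact never empty
   here: a non-maximal prime ideal lies strictly below some maximal ideal.) *)
locale sober_ring = cring +
  assumes sober:
    "\<lbrakk>P \<in> Spec R; P \<notin> MaxSpec R\<rbrakk> \<Longrightarrow> P \<noteq> carrier R \<inter> \<Inter>{Q \<in> Spec R. P \<subset> Q}"

end

theory Submission
  imports Defs
begin

text \<open>
  Every prime ideal \<open>P\<close> of an Artinian ring is maximal, so the condition on non-maximal primes is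
  vacuous. For \<open>x \<notin> P\<close> the chain of ideals generated by the powers of \<open>x\<close> stabilises, giving
  \<open>x\<^sup>n (1 - r x) = 0\<close> for some \<open>r\<close> and \<open>n\<close>. Hence \<open>1 - r x \<in> P\<close>, and every ideal
  containing both \<open>P\<close> and \<open>x\<close> is the whole ring.
\<close>

text \<open>Once the principal ideals of consecutive powers agree, the lower power is itself a
  multiple of the higher one. Commutativity is a separate premise because
  \<open>artinian_ring\<close> extends only \<open>ring\<close>, while \<open>PIdl\<close> collects
  left multiples.\<close>

lemma (in artinian_ring) power_eq_mult_power_Suc:
  assumes "cring R" and x: "x \<in> carrier R"
  obtains r and n :: nat where "r \<in> carrier R" and "x [^] n = r \<otimes> x [^] Suc n"
proof -
  interpret cring R by fact
  have "PIdl (x [^] Suc n) \<subseteq> PIdl (x [^] n)" for n :: nat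
  proof (rule cgenideal_minimal[OF cgenideal_ideal])
    \<comment> \<open>The cofactor is \<open>x\<close>; \<open>PIdl\<close> wants it on the left,
      whereas \<open>nat_pow_Suc\<close> splits it off on the right.\<close>
    show "x [^] Suc n \<in> PIdl (x [^] n)"
      unfolding cgenideal_def using x
      by (intro CollectI exI[of _ x]) (simp add: nat_pow_Suc2[symmetric] del: nat_pow_Suc)
  qed (use x in simp)
  then obtain N :: nat where "\<forall>n\<ge>N. PIdl (x [^] n) = PIdl (x [^] N)"
    using dcc[of "\<lambda>n. PIdl (x [^] n)"] cgenideal_ideal x by blast
  then have "PIdl (x [^] Suc N) = PIdl (x [^] N)"
    by (meson le_SucI order_refl)
  then have "x [^] N \<in> PIdl (x [^] Suc N)"
    using cgenideal_self x by simp
  then show thesis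
    unfolding cgenideal_def using that by blast
qed

lemma (in primeideal) nat_pow_mem_imp_mem:
  assumes "x \<in> carrier R" and "x [^] (n::nat) \<in> I"
  shows "x \<in> I"
  using assms(2)
proof (induction n)
  case 0
  then show ?case
    \<comment> \<open>The zeroth power is \<open>\<one>\<close>, which a proper ideal cannot
      contain.\<close>
    using one_imp_carrier I_notcarr by simp
next
  case (Suc n)
  then show ?case
    using I_prime[of "x [^] n" x] assms(1) by auto
qed

lemma (in artinian_ring) primeideal_imp_maximalideal:
  assumes "primeideal P R"
  shows "maximalideal P R"
proof -
  interpret P: primeideal P R by fact
  show ?thesis
  proof (rule maximalidealI)
    show "ideal P R" by (rule P.is_ideal)
    show "carrier R \<noteq> P" by (rule P.I_notcarr)
    fix J assume "ideal J R" and PJ: "P \<subseteq> J"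
    interpret J: ideal J R by fact
    show "J = P \<or> J = carrier R"
    proof (rule disjCI)
      assume "J \<noteq> carrier R"
      have "x \<in> P" if "x \<in> J" for x
      proof -
        have x: "x \<in> carrier R"
          using that by (rule J.Icarr)
        obtain r and n :: nat
          where r: "r \<in> carrier R" and eq: "x [^] n = r \<otimes> x [^] Suc n"
          \<comment> \<open>Commutativity is available because a \<open>primeideal\<close> lives in
            a \<open>cring\<close>.\<close>
          using power_eq_mult_power_Suc[OF P.is_cring x] by blast
        have "x [^] n \<otimes> (\<one> \<ominus> r \<otimes> x) = x [^] n \<ominus> r \<otimes> x [^] Suc n"
          using x r by (simp add: a_minus_def r_distr r_minus P.m_ac)
        also have "\<dots> = \<zero>"
          using x by (subst eq[symmetric]) (simp add: a_minus_def r_neg)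
        finally have "x [^] n \<otimes> (\<one> \<ominus> r \<otimes> x) \<in> P"
          by simp
        then consider "x [^] n \<in> P" | "\<one> \<ominus> r \<otimes> x \<in> P"
          using P.I_prime[of "x [^] n" "\<one> \<ominus> r \<otimes> x"] x r by auto
        then show ?thesis
        proof cases
          case 1
          with x show ?thesis
            by (rule P.nat_pow_mem_imp_mem)
        next
          case 2
          \<comment> \<open>This case is contradictory: both summands lie in \<open>J\<close>, so
            their sum \<open>\<one>\<close> would make \<open>J\<close> the whole ring.\<close>
          then have "(\<one> \<ominus> r \<otimes> x) \<oplus> r \<otimes> x \<in> J"
            using PJ J.I_l_closed[OF that r] by (blast intro: J.a_closed)
          then have "\<one> \<in> J"
            using x r by (simp add: a_minus_def a_assoc l_neg)
          then show ?thesis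
            using J.one_imp_carrier \<open>J \<noteq> carrier R\<close> by blast
        qed
      qed
      then show "J = P"
        using PJ by blast
    qed
  qed
qed

theorem corollary2p3:
  fixes R :: "('a, 'b) ring_scheme" (structure)
  assumes "cring R"
    and "artinian_ring R"
  shows "sober_ring R"
proof -
  interpret cring R by fact
  show ?thesis
    by unfold_locales
      (use artinian_ring.primeideal_imp_maximalideal[OF assms(2)] in
        \<open>auto simp: Spec_def MaxSpec_def\<close>)
qed

end
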